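(* For every $\varepsilon>0$ there exist arbitrarily large positive integers $n$ and a finite set $V$ of $n$ positive integers such that the number of edges of the Diophantine graph $D(V)$ satisfies $e(D(V))>n(\log n)^{2\log 2-\varepsilon}$.
   Context: For a finite set $V$ of positive integers, the Diophantine graph $D(V)$ has vertex set $V$, and two distinct elements $a,b\in V$ are linked by an edge if and only if $ab+1$ is a perfect square; $e(D(V))$ denotes its number of edges. $\log$ is the natural logarithm. *)

theory Defs
  imports "HOL-Analysis.Analysis" "HOL-Computational_Algebra.Nth_Powers"
begin

text \<open>
  A simple graph is a pair of a vertex set and a set of edges, each edge being an unordered
  pair (a two-element set) of vertices.
\<close>
type_synonym 'a graph = "'a set \<times> 'a set set"

definition num_edges :: "'a graph \<Rightarrow> nat" where
  "num_edges G = card (snd G)"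

definition diophantine_graph :: "nat set \<Rightarrow> nat graph" where
  "diophantine_graph V =
     (V, {{a, b} | a b. a \<in> V \<and> b \<in> V \<and> a \<noteq> b \<and> is_square (a * b + 1)})"

end

theory Submission
  imports Defs "HOL-Number_Theory.Cong" "HOL-Real_Asymp.Real_Asymp"
begin

text \<open>
  If \<open>x w = y z + 1\<close>, then \<open>2xy \<cdot> 2zw + 1 = (2yz + 1)\<^sup>2\<close>. Every coprime pair \<open>x, y \<ge> 2\<close> has such
  \<open>z, w\<close> with \<open>0 < z < x\<close> and \<open>0 < w < y\<close>, and the resulting edge \<open>{2xy, 2zw}\<close> determines the pair,
  so the pairs with \<open>xy \<le> N\<close> give at least \<open>c N log N\<close> edges. Keep only the numbers \<open>2a\<close>, \<open>a \<le> N\<close>,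
  such that \<open>a\<close> has at least \<open>(2 - \<delta>) log log N\<close> prime factors, i.e. \<open>2\<^bsup>\<omega>(a)\<^esup> \<ge> T = (log N)\<^bsup>2 log 2 - \<delta>\<^esup>\<close>
  (with another \<open>\<delta>\<close>). As the sum of \<open>2\<^bsup>\<omega>(a)\<^esup>\<close> over \<open>a \<le> N\<close> is \<open>O(N log N)\<close>, there are only
  \<open>O(N log N / T)\<close> of them. Yet few edges are lost: as \<open>a\<close> arises from at most \<open>2\<^bsup>\<omega>(a)\<^esup>\<close> coprime pairs, the
  number of lost edges is at most a sum of \<open>2\<^bsup>\<omega>(a)\<^esup> \<le> T\<^sup>s 2\<^bsup>(1-s)\<omega>(a)\<^esup>\<close>, which for small \<open>s > 0\<close> is
  \<open>O(N (log N)\<^bsup>1-\<eta>\<^esup>)\<close> with \<open>\<eta> > 0\<close>.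
\<close>

subsection \<open>Moments of the number of prime factors\<close>

lemma prime_dvd_prod_primes_iff:
  fixes S :: "nat set"
  assumes "finite S" "\<And>p. p \<in> S \<Longrightarrow> prime p" "prime q"
  shows "q dvd \<Prod>S \<longleftrightarrow> q \<in> S"
proof -
  have "q dvd \<Prod>S \<longleftrightarrow> (\<exists>p\<in>S. q dvd p)"
    using assms by (simp add: prime_dvd_prod_iff)
  then show ?thesis
    using primes_dvd_imp_eq[OF assms(3) assms(2)] by (metis dvd_refl)
qed

text \<open>By unique factorization a set of primes is recovered from its product as the set of
  prime divisors. Hence expanding an Euler product gives a sum over distinct integers.\<close>

lemma inj_on_prod_primes:
  fixes P :: "nat set"
  assumes "finite P" "\<And>p. p \<in> P \<Longrightarrow> prime p"
  shows "inj_on (\<lambda>S. \<Prod>S) (Pow P)"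
proof (rule inj_onI)
  fix S T assume S: "S \<in> Pow P" and T: "T \<in> Pow P" and eq: "\<Prod>S = \<Prod>T"
  have fin: "finite S" "finite T"
    using S T assms(1) by (auto intro: finite_subset)
  have "q \<in> S \<longleftrightarrow> q \<in> T" if "prime q" for q
  proof -
    have "q \<in> S \<longleftrightarrow> q dvd \<Prod>S"
      using prime_dvd_prod_primes_iff[OF fin(1) _ that] S assms(2) by blast
    also have "\<dots> \<longleftrightarrow> q \<in> T"
      using prime_dvd_prod_primes_iff[OF fin(2) _ that] T assms(2) unfolding eq by blast
    finally show ?thesis .
  qed
  then show "S = T"
    using S T assms(2) by blast
qed

lemma prod_primes_dvd_iff:
  fixes S :: "nat set"
  assumes "finite S" "\<And>p. p \<in> S \<Longrightarrow> prime p" "b > 0"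
  shows "\<Prod>S dvd b \<longleftrightarrow> S \<subseteq> prime_factors b"
proof
  assume "\<Prod>S dvd b"
  then show "S \<subseteq> prime_factors b"
    using assms by (auto simp: in_prime_factors_iff intro: dvd_trans[OF dvd_prodI])
next
  assume "S \<subseteq> prime_factors b"
  with assms(1,2) show "\<Prod>S dvd b"
  proof (induction S rule: finite_induct)
    case (insert p S)
    have "\<not> p dvd \<Prod>S"
      using insert prime_dvd_prod_primes_iff[of S p] by auto
    then have "coprime p (\<Prod>S)"
      using insert.prems by (intro prime_imp_coprime) auto
    then show ?case
      using insert by (auto intro: divides_mult)
  qed auto
qed

text \<open>Binomial expansion over the sets of prime divisors of \<open>b\<close>. The index set is
  enlarged to one that does not depend on \<open>b\<close>, so that a sum over \<open>b\<close> can
  be interchanged with it.\<close>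

lemma power_card_prime_factors_eq:
  fixes \<alpha> :: real and b N :: nat
  assumes "0 < b" "b \<le> N"
  shows "(1 + \<alpha>) ^ card (prime_factors b) =
    (\<Sum>S\<in>Pow {p. prime p \<and> p \<le> N}. if \<Prod>S dvd b then \<alpha> ^ card S else 0)"
proof -
  let ?P = "{p. prime p \<and> p \<le> N}"
  have fin: "finite ?P" by (rule finite_subset[of _ "{..N}"]) auto
  have sub: "prime_factors b \<subseteq> ?P"
  proof
    fix p assume "p \<in> prime_factors b"
    then have "prime p" "p dvd b" by auto
    then show "p \<in> ?P" using dvd_imp_le[of p b] assms by auto
  qed
  have "(1 + \<alpha>) ^ card (prime_factors b) = (\<Prod>p\<in>prime_factors b. \<alpha> + 1)"
    by (simp add: add.commute)
  also have "\<dots> = (\<Sum>S\<in>Pow (prime_factors b). \<alpha> ^ card S)"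
    by (subst prod_add) simp_all
  also have "\<dots> = (\<Sum>S\<in>Pow ?P. if S \<subseteq> prime_factors b then \<alpha> ^ card S else 0)"
    using fin sub by (intro sum.mono_neutral_cong_left) auto
  also have "\<dots> = (\<Sum>S\<in>Pow ?P. if \<Prod>S dvd b then \<alpha> ^ card S else 0)"
  proof (rule sum.cong)
    fix S assume "S \<in> Pow ?P"
    then have "finite S" "\<And>p. p \<in> S \<Longrightarrow> prime p"
      using fin by (auto intro: finite_subset)
    from prod_primes_dvd_iff[OF this \<open>0 < b\<close>]
    show "(if S \<subseteq> prime_factors b then \<alpha> ^ card S else 0) =
        (if \<Prod>S dvd b then \<alpha> ^ card S else 0)" by simp
  qed simp
  finally show ?thesis .
qed

section \<open>Upper bounds for finite Euler products\<close>

lemma sum_powr_minus_le: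
  fixes \<sigma> :: real
  assumes "\<sigma> > 1"
  shows "(\<Sum>n=1..M. real n powr -\<sigma>) \<le> \<sigma> / (\<sigma> - 1)"
proof -
  \<comment> \<open>Comparison with the integral, in the form of the mean value theorem for
    \<open>x powr (1 - \<sigma>)\<close>; these bounds telescope, and with the first term they sum
    to at most 1 + 1 / (\<sigma> - 1).\<close>
  have step: "real (Suc M) powr -\<sigma> \<le> (real M powr (1 - \<sigma>) - real (Suc M) powr (1 - \<sigma>)) / (\<sigma> - 1)"
    if "M > 0" for M
  proof -
    have "\<exists>z. real M < z \<and> z < real (Suc M) \<and>
      real (Suc M) powr (1 - \<sigma>) - real M powr (1 - \<sigma>) =
        (real (Suc M) - real M) * ((1 - \<sigma>) * z powr (1 - \<sigma> - 1))"
      using that by (intro MVT2) (auto intro!: derivative_eq_intros)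
    then obtain z where z: "real M < z" "z < real (Suc M)"
      "real (Suc M) powr (1 - \<sigma>) - real M powr (1 - \<sigma>) = (1 - \<sigma>) * z powr -\<sigma>"
      by auto
    have "real (Suc M) powr -\<sigma> \<le> z powr -\<sigma>"
      using z assms that by (intro powr_mono2') auto
    also have "z powr -\<sigma> = (real M powr (1 - \<sigma>) - real (Suc M) powr (1 - \<sigma>)) / (\<sigma> - 1)"
      using z(3) assms by (simp add: field_simps)
    finally show ?thesis .
  qed
  have "(\<Sum>n=1..M. real n powr -\<sigma>) \<le> 1 + (1 - real M powr (1 - \<sigma>)) / (\<sigma> - 1)" if "M > 0"
    using that
  proof (induction M rule: nat_induct_non_zero)
    case 1
    then show ?case by simp
  next
    case (Suc M)
    then show ?case
      using step[of M] by (simp add: diff_divide_distrib)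
  qed
  also have "1 + (1 - real M powr (1 - \<sigma>)) / (\<sigma> - 1) \<le> \<sigma> / (\<sigma> - 1)"
  proof -
    have "1 + (1 - real M powr (1 - \<sigma>)) / (\<sigma> - 1) \<le> 1 + 1 / (\<sigma> - 1)"
      using assms by (intro add_left_mono divide_right_mono) auto
    also have "\<dots> = \<sigma> / (\<sigma> - 1)"
      using assms by (simp add: field_simps)
    finally show ?thesis .
  qed
  finally show ?thesis
    using assms by (cases "M = 0") auto
qed

text \<open>Expanded, the product is a sum of \<open>n powr -\<sigma>\<close> over distinct
  squarefree \<open>n\<close>. All of them divide \<open>\<Prod>P\<close>, so it is at most a
  partial sum of the zeta series.\<close>

lemma prod_primes_le:
  fixes \<sigma> :: real and P :: "nat set"
  assumes "\<sigma> > 1" "finite P" "\<And>p. p \<in> P \<Longrightarrow> prime p"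
  shows "(\<Prod>p\<in>P. 1 + real p powr -\<sigma>) \<le> \<sigma> / (\<sigma> - 1)"
proof -
  have pos: "p > 0" if "p \<in> P" for p
    using assms(3)[OF that] by (rule prime_gt_0_nat)
  have "(\<Prod>p\<in>P. 1 + real p powr -\<sigma>) = (\<Sum>S\<in>Pow P. \<Prod>p\<in>S. real p powr -\<sigma>)"
    by (subst add.commute, subst prod_add) (use assms in auto)
  also have "\<dots> = (\<Sum>S\<in>Pow P. real (\<Prod>S) powr -\<sigma>)"
    by (intro sum.cong refl) (simp add: prod_powr_distrib)
  also have "\<dots> = (\<Sum>n\<in>(\<lambda>S. \<Prod>S) ` Pow P. real n powr -\<sigma>)"
    by (subst sum.reindex) (use inj_on_prod_primes assms in auto)
  also have "\<dots> \<le> (\<Sum>n=1..\<Prod>P. real n powr -\<sigma>)"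
  proof (rule sum_mono2)
    show "(\<lambda>S. \<Prod>S) ` Pow P \<subseteq> {1..\<Prod>P}"
    proof
      fix n assume "n \<in> (\<lambda>S. \<Prod>S) ` Pow P"
      then obtain S where S: "S \<subseteq> P" "n = \<Prod>S" by auto
      have "n dvd \<Prod>P"
        using S assms(2) by (auto intro: prod_dvd_prod_subset)
      moreover have "\<Prod>P > 0" "n > 0"
        using pos S by (auto intro!: prod_pos)
      ultimately show "n \<in> {1..\<Prod>P}"
        by (auto intro: dvd_imp_le)
    qed
  qed auto
  also have "\<dots> \<le> \<sigma> / (\<sigma> - 1)"
    by (rule sum_powr_minus_le) fact
  finally show ?thesis .
qed

text \<open>Take the logarithm of the Euler product: since ln (1 + u) \<ge> u - u^2, passing from
  the logarithms to the terms themselves costs at most the sum of the squares, which the zeta bound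
  at exponent 2 limits to 2.\<close>

lemma sum_primes_powr_le:
  fixes \<sigma> :: real and P :: "nat set"
  assumes "\<sigma> > 1" "finite P" "\<And>p. p \<in> P \<Longrightarrow> prime p"
  shows "(\<Sum>p\<in>P. real p powr -\<sigma>) \<le> ln (\<sigma> / (\<sigma> - 1)) + 2"
proof -
  have pos: "p > 0" if "p \<in> P" for p
    using assms(3)[OF that] by (rule prime_gt_0_nat)
  have "(\<Sum>p\<in>P. real p powr -\<sigma>) \<le> (\<Sum>p\<in>P. ln (1 + real p powr -\<sigma>) + real p powr -2)"
  proof (rule sum_mono)
    fix p assume p: "p \<in> P"
    define u where "u = real p powr -\<sigma>"
    have "u \<le> real p powr 0"
      unfolding u_def using pos[OF p] assms(1) by (intro powr_mono) auto
    then have "u \<le> 1" "0 \<le> u"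
      using pos[OF p] by (auto simp: u_def)
    then have "u - u\<^sup>2 \<le> ln (1 + u)"
      by (intro ln_one_plus_pos_lower_bound)
    moreover have "u\<^sup>2 \<le> real p powr -2"
    proof -
      have "u\<^sup>2 = real p powr (-2 * \<sigma>)"
        by (simp add: u_def power2_eq_square flip: powr_add)
      also have "\<dots> \<le> real p powr -2"
        using pos[OF p] assms(1) by (intro powr_mono) auto
      finally show ?thesis .
    qed
    ultimately show "real p powr -\<sigma> \<le> ln (1 + real p powr -\<sigma>) + real p powr -2"
      by (simp add: u_def)
  qed
  also have "\<dots> = ln (\<Prod>p\<in>P. 1 + real p powr -\<sigma>) + (\<Sum>p\<in>P. real p powr -2)"
  proof -
    have "1 + real p powr -\<sigma> > 0" for p
      by (intro add_pos_nonneg) auto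
    then have "1 + real p powr -\<sigma> \<noteq> 0" for p
      by (metis less_irrefl)
    then show ?thesis
      by (subst ln_prod) (simp_all add: sum.distrib assms(2))
  qed
  also have "ln (\<Prod>p\<in>P. 1 + real p powr -\<sigma>) \<le> ln (\<sigma> / (\<sigma> - 1))"
    using assms by (intro ln_mono prod_primes_le) (auto intro!: prod_pos add_pos_nonneg)
  also have "(\<Sum>p\<in>P. real p powr -2) \<le> (\<Sum>p=1..\<Prod>P. real p powr -2)"
  proof (rule sum_mono2)
    show "P \<subseteq> {1..\<Prod>P}"
    proof
      fix p assume "p \<in> P"
      then have "p dvd \<Prod>P" using assms(2) by (auto intro: dvd_prodI)
      moreover have "\<Prod>P > 0" using pos by (auto intro!: prod_pos)
      ultimately show "p \<in> {1..\<Prod>P}" using pos[OF \<open>p \<in> P\<close>] by (auto intro: dvd_imp_le)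
    qed
  qed auto
  also have "\<dots> \<le> 2"
    using sum_powr_minus_le[of 2 "\<Prod>P"] by simp
  finally show ?thesis by simp
qed

text \<open>With 1 + t \<le> exp t the weight \<alpha> moves in front of the prime sum and so
  becomes the exponent of \<sigma> / (\<sigma> - 1). Later this yields the power \<alpha> of log
  N.\<close>

lemma prod_primes_weighted_le:
  fixes \<alpha> \<sigma> :: real and P :: "nat set"
  assumes "\<sigma> > 1" "finite P" "\<And>p. p \<in> P \<Longrightarrow> prime p" "0 \<le> \<alpha>" "\<alpha> \<le> 1"
  shows "(\<Prod>p\<in>P. 1 + \<alpha> * real p powr -\<sigma>) \<le> exp 2 * (\<sigma> / (\<sigma> - 1)) powr \<alpha>"
proof -
  have "(\<Prod>p\<in>P. 1 + \<alpha> * real p powr -\<sigma>) \<le> (\<Prod>p\<in>P. exp (\<alpha> * real p powr -\<sigma>))"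
    using assms by (intro prod_mono) (auto intro: add_nonneg_nonneg)
  also have "\<dots> = exp (\<alpha> * (\<Sum>p\<in>P. real p powr -\<sigma>))"
    by (simp add: exp_sum assms(2) sum_distrib_left)
  also have "\<dots> \<le> exp (\<alpha> * (ln (\<sigma> / (\<sigma> - 1)) + 2))"
    using assms by (auto intro!: mult_left_mono sum_primes_powr_le)
  also have "\<dots> \<le> exp (\<alpha> * ln (\<sigma> / (\<sigma> - 1)) + 2)"
    using assms by (simp add: algebra_simps)
  also have "\<dots> = exp 2 * (\<sigma> / (\<sigma> - 1)) powr \<alpha>"
    using assms by (simp add: powr_def exp_add)
  finally show ?thesis .
qed

section \<open>Moment sums with the weight sqrt (N / b)\<close>

lemma sum_inverse_sqrt_le: "(\<Sum>m=1..M. 1 / sqrt (real m)) \<le> 2 * sqrt (real M)"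
proof (induction M)
  case (Suc M)
  have "1 / sqrt (real (Suc M)) \<le> 2 * (sqrt (real (Suc M)) - sqrt (real M))"
  proof -
    have "(sqrt (real (Suc M)) - sqrt (real M)) * (sqrt (real (Suc M)) + sqrt (real M)) = 1"
      by (simp add: algebra_simps)
    then have "sqrt (real (Suc M)) - sqrt (real M) = 1 / (sqrt (real (Suc M)) + sqrt (real M))"
      by (metis nonzero_eq_divide_eq mult_zero_right zero_neq_one)
    also have "\<dots> \<ge> 1 / (2 * sqrt (real (Suc M)))"
      by (intro divide_left_mono) (auto intro!: mult_pos_pos add_pos_nonneg)
    finally show ?thesis by (simp add: field_simps)
  qed
  then show ?case using Suc by simp
qed simp

text \<open>Writing b = d m leaves sqrt (N / d) times a sum of 1 / sqrt m, so the weight costs only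
  a factor 2 compared with counting multiples. The sum is empty for d > N, and this cutoff is kept
  because Rankin's method applies only to d \<le> N.\<close>

lemma sum_multiples_sqrt_le:
  fixes N d :: nat
  assumes "N > 0" "d > 0"
  shows "(\<Sum>b\<in>{1..N}. if d dvd b then sqrt (N / b) else 0) \<le> (if d \<le> N then 2 * N / d else 0)"
proof -
  have "(\<Sum>b\<in>{1..N}. if d dvd b then sqrt (N / b) else 0) = (\<Sum>b\<in>{b\<in>{1..N}. d dvd b}. sqrt (N / b))"
    by (intro sum.inter_filter[symmetric]) simp
  also have "{b\<in>{1..N}. d dvd b} = (\<lambda>m. d * m) ` {1..N div d}"
  proof (intro set_eqI iffI)
    fix b assume "b \<in> {b\<in>{1..N}. d dvd b}"
    then obtain m where m: "b = d * m" "1 \<le> b" "b \<le> N" by (auto elim: dvdE)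
    then have "m \<in> {1..N div d}"
      using assms by (cases "m = 0") (auto simp: less_eq_div_iff_mult_less_eq mult.commute[of d])
    then show "b \<in> (\<lambda>m. d * m) ` {1..N div d}" using m by blast
  next
    fix b assume "b \<in> (\<lambda>m. d * m) ` {1..N div d}"
    then obtain m where "m \<in> {1..N div d}" and m: "b = d * m" by blast
    then have "1 \<le> m" "m \<le> N div d" by auto
    then have "d * m \<le> N"
      using assms by (simp add: less_eq_div_iff_mult_less_eq mult.commute[of d])
    then show "b \<in> {b\<in>{1..N}. d dvd b}" using m \<open>1 \<le> m\<close> assms by (auto simp: Suc_le_eq)
  qed
  also have "(\<Sum>b\<in>\<dots>. sqrt (N / b)) = (\<Sum>m=1..N div d. sqrt (N / (d * m)))"
    using assms by (subst sum.reindex) (auto simp: inj_on_def)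
  also have "\<dots> = sqrt (N / d) * (\<Sum>m=1..N div d. 1 / sqrt (real m))"
    by (simp add: sum_distrib_left real_sqrt_divide real_sqrt_mult)
  also have "\<dots> \<le> sqrt (N / d) * (2 * sqrt (N div d))"
    by (intro mult_left_mono sum_inverse_sqrt_le) auto
  also have "\<dots> \<le> (if d \<le> N then 2 * N / d else 0)"
  proof (cases "d \<le> N")
    case True
    have "sqrt (N / d) * (2 * sqrt (N div d)) \<le> sqrt (N / d) * (2 * sqrt (N / d))"
      by (intro mult_left_mono real_sqrt_le_mono) (auto intro: of_nat_div_le_of_nat)
    also have "\<dots> = 2 * (sqrt (N / d) * sqrt (N / d))"
      by (simp only: mult_ac)
    also have "\<dots> = 2 * (N / d)"
      by (subst real_sqrt_mult_self) simp
    finally show ?thesis using True by simp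
  qed simp
  finally show ?thesis .
qed

text \<open>Rankin's method: for \<open>d \<le> N\<close> and \<open>\<sigma> = 1 + 1 / ln N\<close> one has \<open>1 / d \<le> e d\<^bsup>-\<sigma>\<^esup>\<close>, which makes the
  Euler product over the primes up to \<open>N\<close> available without any estimate on prime sums.\<close>

lemma sum_power_card_prime_factors_le:
  fixes \<alpha> :: real and N :: nat
  assumes "N \<ge> 2" "0 \<le> \<alpha>" "\<alpha> \<le> 1"
  shows "(\<Sum>b=1..N. (1 + \<alpha>) ^ card (prime_factors b) * sqrt (N / b))
    \<le> 2 * exp 3 * N * (1 + ln N) powr \<alpha>"
proof -
  define P where "P = {p. prime p \<and> p \<le> N}"
  define \<sigma> where "\<sigma> = 1 + 1 / ln N"
  have P: "finite P" "\<And>p. p \<in> P \<Longrightarrow> prime p"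
    by (auto simp: P_def intro: finite_subset[of _ "{..N}"])
  have lnN: "ln N > 0" using assms by simp
  have \<sigma>: "\<sigma> > 1" "\<sigma> / (\<sigma> - 1) = 1 + ln N"
    using lnN by (auto simp: \<sigma>_def field_simps)
  have pos: "\<Prod>S > 0" if "S \<subseteq> P" for S
    using that P prime_gt_0_nat by (fastforce intro: prod_pos)
  have inv_le: "1 / d \<le> exp 1 * d powr -\<sigma>" if "0 < d" "d \<le> N" for d :: nat
  proof -
    have "ln d / ln N \<le> 1"
      using that lnN by (subst divide_le_eq_1) auto
    then have "exp (- ln d) \<le> exp (1 - \<sigma> * ln d)"
      by (simp add: \<sigma>_def algebra_simps)
    then show ?thesis
      using that by (simp add: powr_def exp_diff exp_minus field_simps)
  qed
  have "(\<Sum>b=1..N. (1 + \<alpha>) ^ card (prime_factors b) * sqrt (N / b))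
      = (\<Sum>b=1..N. \<Sum>S\<in>Pow P. \<alpha> ^ card S * (if \<Prod>S dvd b then sqrt (N / b) else 0))"
  proof (rule sum.cong)
    fix b assume "b \<in> {1..N}"
    then show "(1 + \<alpha>) ^ card (prime_factors b) * sqrt (N / b) =
      (\<Sum>S\<in>Pow P. \<alpha> ^ card S * (if \<Prod>S dvd b then sqrt (N / b) else 0))"
      using power_card_prime_factors_eq[of b N \<alpha>]
      by (auto simp: sum_distrib_right simp flip: P_def intro!: sum.cong)
  qed simp
  also have "\<dots> = (\<Sum>S\<in>Pow P. \<alpha> ^ card S * (\<Sum>b=1..N. if \<Prod>S dvd b then sqrt (N / b) else 0))"
    by (subst sum.swap) (simp add: sum_distrib_left)
  also have "\<dots> \<le> (\<Sum>S\<in>Pow P. \<alpha> ^ card S * (2 * N * (exp 1 * real (\<Prod>S) powr -\<sigma>)))"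
  proof (intro sum_mono mult_left_mono)
    fix S assume "S \<in> Pow P"
    then have S: "\<Prod>S > 0" using pos by auto
    have "(\<Sum>b=1..N. if \<Prod>S dvd b then sqrt (N / b) else 0)
        \<le> (if \<Prod>S \<le> N then 2 * N / \<Prod>S else 0)"
      using assms S by (intro sum_multiples_sqrt_le) auto
    also have "\<dots> \<le> 2 * N * (exp 1 * real (\<Prod>S) powr -\<sigma>)"
    proof (cases "\<Prod>S \<le> N")
      case True
      then show ?thesis
        using mult_left_mono[OF inv_le[OF S True], of "2 * N"] by simp
    qed auto
    finally show "(\<Sum>b=1..N. if \<Prod>S dvd b then sqrt (N / b) else 0)
        \<le> 2 * N * (exp 1 * real (\<Prod>S) powr -\<sigma>)" .
  qed (use assms in auto)
  also have "\<dots> = 2 * N * exp 1 * (\<Sum>S\<in>Pow P. \<Prod>p\<in>S. \<alpha> * real p powr -\<sigma>)"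
    by (simp add: sum_distrib_left prod.distrib prod_powr_distrib mult_ac)
  also have "(\<Sum>S\<in>Pow P. \<Prod>p\<in>S. \<alpha> * real p powr -\<sigma>) = (\<Prod>p\<in>P. 1 + \<alpha> * real p powr -\<sigma>)"
    using prod_add[OF P(1), of "\<lambda>p. \<alpha> * real p powr -\<sigma>" "\<lambda>_. 1"]
    by (simp only: prod.neutral_const mult_1_right add.commute)
  \<comment> \<open>The final \<open>exp 3\<close> combines \<open>exp 1\<close> from Rankin's
    method with \<open>exp 2\<close> from the Euler product, where \<sigma> / (\<sigma> - 1) equals
    1 + ln N.\<close>
  also have "2 * N * exp 1 * \<dots> \<le> 2 * N * exp 1 * (exp 2 * (1 + ln N) powr \<alpha>)"
    using prod_primes_weighted_le[OF \<sigma>(1) P assms(2,3)] \<sigma>(2) by (intro mult_left_mono) auto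
  also have "\<dots> = 2 * exp 3 * N * (1 + ln N) powr \<alpha>"
    using exp_add[of 1 "2::real"] by simp
  finally show ?thesis .
qed

subsection \<open>Coprime pairs\<close>

definition coprime_pairs :: "nat \<Rightarrow> (nat \<times> nat) set" where
  "coprime_pairs N = {(x, y). coprime x y \<and> x * y \<in> {1..N}}"

lemma finite_coprime_pairs: "finite (coprime_pairs N)"
proof (rule finite_subset)
  show "coprime_pairs N \<subseteq> {1..N} \<times> {1..N}"
  proof safe
    fix x y assume "(x, y) \<in> coprime_pairs N"
    then have "x * y \<le> N" "x > 0" "y > 0" by (auto simp: coprime_pairs_def Suc_le_eq)
    moreover from this have "x \<le> x * y" "y \<le> x * y" by auto
    ultimately have "0 < x \<and> x \<le> N" "0 < y \<and> y \<le> N" by linarith+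
    then show "x \<in> {1..N}" "y \<in> {1..N}" by auto
  qed
qed auto

text \<open>Each prime power in \<open>a\<close> goes entirely to \<open>x\<close> or entirely to
  \<open>y\<close>, so the primes dividing \<open>x\<close> determine the factorization.\<close>

lemma card_coprime_factorizations_le:
  fixes a :: nat
  assumes "a > 0"
  shows "card {(x, y). coprime x y \<and> x * y = a} \<le> 2 ^ card (prime_factors a)"
proof -
  \<comment> \<open>Stated as a divisibility so that applying it in both directions gives equality.
    A prime dividing both \<open>x\<close> and \<open>y'\<close> would also divide
    \<open>x'\<close>, against the coprimality of \<open>x'\<close> and \<open>y'\<close>; hence
    \<open>x\<close> divides x' y' through its factor \<open>x'\<close>.\<close>
  have dvd: "x dvd x'"
    if "coprime x' y'" "x * y = a" "x' * y' = a" "prime_factors x = prime_factors x'"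
    for x y x' y' :: nat
  proof -
    have nz: "x > 0" "x' > 0" using that(2,3) assms by (auto intro: gr0I)
    have "coprime x y'"
    proof (rule ccontr)
      assume "\<not> coprime x y'"
      then have "gcd x y' \<noteq> 1" by (simp add: coprime_iff_gcd_eq_1)
      then obtain p where "prime p" "p dvd gcd x y'" using prime_factor_nat by blast
      then have p: "prime p" "p dvd x" "p dvd y'" by simp_all
      have "p \<in> prime_factors x"
        using p nz by (intro prime_factorsI) simp_all
      then have "p \<in> prime_factors x'"
        unfolding that(4) .
      then have "p dvd x'" by (rule in_prime_factors_imp_dvd)
      from coprime_common_divisor[OF that(1) this p(3)] p(1) show False
        by (meson not_prime_unit)
    qed
    moreover have "x dvd x' * y'" using that(2,3) by (metis dvd_triv_left)
    ultimately show ?thesis by (simp add: coprime_dvd_mult_left_iff)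
  qed
  let ?F = "{(x, y). coprime x y \<and> x * y = a}"
  have "inj_on (\<lambda>(x, y). prime_factors x) ?F"
  proof (rule inj_onI, clarify)
    fix x y x' y' :: nat
    assume *: "coprime x y" "a = x * y" "coprime x' y'" "x' * y' = x * y"
      "prime_factors x = prime_factors x'"
    then have "x = x'"
      by (intro dvd_antisym dvd[of x' y' x y] dvd[of x y x' y']) auto
    moreover from this have "y = y'" using * assms by auto
    ultimately show "x = x' \<and> y = y'" by simp
  qed
  moreover have "(\<lambda>(x, y). prime_factors x) ` ?F \<subseteq> Pow (prime_factors a)"
    using assms by (auto simp: in_prime_factors_iff)
  ultimately have "card ?F \<le> card (Pow (prime_factors a))"
    by (intro card_inj_on_le) auto
  then show ?thesis by (simp add: card_Pow)
qed

text \<open>Group the pairs by their product. This reduces the loss over pairs to weighted sums of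
  2^\<omega>(b).\<close>

lemma sum_coprime_pairs_le:
  fixes w :: "nat \<Rightarrow> real"
  assumes "\<And>b. w b \<ge> 0"
  shows "(\<Sum>(x, y)\<in>coprime_pairs N. w (x * y)) \<le> (\<Sum>b=1..N. 2 ^ card (prime_factors b) * w b)"
proof -
  let ?m = "\<lambda>q. fst q * snd q :: nat"
  have "?m ` coprime_pairs N \<subseteq> {1..N}"
    by (auto simp: coprime_pairs_def)
  from sum.group[OF finite_coprime_pairs finite_atLeastAtMost this, of "\<lambda>q. w (?m q)"]
  have "(\<Sum>(x, y)\<in>coprime_pairs N. w (x * y)) =
      (\<Sum>b=1..N. \<Sum>q\<in>{q \<in> coprime_pairs N. ?m q = b}. w (?m q))"
    unfolding case_prod_beta by (rule sym)
  also have "\<dots> = (\<Sum>b=1..N. real (card {q \<in> coprime_pairs N. ?m q = b}) * w b)"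
  proof (rule sum.cong)
    fix b
    have "(\<Sum>q\<in>{q \<in> coprime_pairs N. ?m q = b}. w (?m q)) =
        (\<Sum>q\<in>{q \<in> coprime_pairs N. ?m q = b}. w b)"
      by (rule sum.cong) auto
    then show "(\<Sum>q\<in>{q \<in> coprime_pairs N. ?m q = b}. w (?m q)) =
        real (card {q \<in> coprime_pairs N. ?m q = b}) * w b"
      by (simp only: sum_constant)
  qed simp
  also have "\<dots> \<le> (\<Sum>b=1..N. 2 ^ card (prime_factors b) * w b)"
  proof (intro sum_mono mult_right_mono assms)
    fix b assume b: "b \<in> {1..N}"
    then have "{q \<in> coprime_pairs N. fst q * snd q = b} = {(x, y). coprime x y \<and> x * y = b}"
      by (auto simp: coprime_pairs_def)
    then have "card {q \<in> coprime_pairs N. fst q * snd q = b} \<le> 2 ^ card (prime_factors b)"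
      using card_coprime_factorizations_le[of b] b by simp
    then have "real (card {q \<in> coprime_pairs N. fst q * snd q = b})
        \<le> real (2 ^ card (prime_factors b))"
      by (rule of_nat_mono)
    then show "real (card {q \<in> coprime_pairs N. fst q * snd q = b}) \<le> 2 ^ card (prime_factors b)"
      by (simp only: of_nat_power of_nat_numeral)
  qed
  finally show ?thesis .
qed

text \<open>Telescoping with 1 / (n (n + 1)) starts only after the term 1/4, which is kept exactly.
  This gives a bound below 1.\<close>

lemma sum_inverse_squares_le: "(\<Sum>g=2..N. 1 / real g ^ 2) \<le> 3 / 4"
proof (cases "N \<ge> 2")
  case True
  then have "(\<Sum>g=2..N. 1 / real g ^ 2) \<le> 3 / 4 - 1 / real N"
  proof (induction N rule: dec_induct)
    case (step n)
    have "1 / real (Suc n) ^ 2 \<le> 1 / (real n * real (Suc n))"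
      using step by (intro divide_left_mono) (auto simp: power2_eq_square)
    also have "\<dots> = 1 / real n - 1 / real (Suc n)"
      using step by (simp add: field_simps)
    finally show ?case using step by simp
  qed simp
  then show ?thesis by (smt (verit) divide_nonneg_nonneg of_nat_0_le_iff)
qed simp

text \<open>All pairs number about \<open>N H\<^sub>N\<close>, and those with a common factor \<open>g\<close> at most
  \<open>N H\<^sub>N / g\<^sup>2\<close>; it matters only that the sum of \<open>1/g\<^sup>2\<close> over \<open>g \<ge> 2\<close> stays below 1.\<close>

lemma card_coprime_pairs_ge: "real (card (coprime_pairs N)) \<ge> real N * (harm N / 4 - 1)"
proof -
  \<comment> \<open>\<open>A\<close> consists of the lattice points with x y \<le> N;
    \<open>M g\<close> contains those of them with gcd equal to \<open>g\<close>, written as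
    \<open>g\<close> times a pair of product at most N / g^2.\<close>
  define A where "A = (SIGMA x:{1..N}. {1..N div x})"
  define M where "M g = (\<lambda>(x, y). (g * x, g * y)) ` (SIGMA x:{1..N}. {1..N div (g\<^sup>2 * x)})" for g
  have fin: "finite A" "\<And>g. finite (M g)" by (auto simp: A_def M_def)
  have "A \<subseteq> coprime_pairs N \<union> (\<Union>g\<in>{2..N}. M g)"
  proof clarify
    fix x y assume xy: "(x, y) \<in> A" "(x, y) \<notin> (\<Union>g\<in>{2..N}. M g)"
    then have *: "x > 0" "y > 0" "x * y \<le> N"
      by (auto simp: A_def less_eq_div_iff_mult_less_eq Suc_le_eq mult.commute)
    have "coprime x y"
    proof (rule ccontr)
      define g where "g = gcd x y"
      assume "\<not> coprime x y"
      then have "g \<noteq> 1" "g > 0" using * by (auto simp: g_def coprime_iff_gcd_eq_1)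
      then have "g \<ge> 2" by simp
      have "g dvd x" "g dvd y" by (simp_all add: g_def)
      then obtain x' y' where x': "x = g * x'" and y': "y = g * y'"
        by (elim dvdE)
      have pos: "x' > 0" "y' > 0" using x' y' * by auto
      have "x \<le> x * y" using * by simp
      then have le: "x \<le> N" using *(3) by (rule le_trans)
      have "x' dvd x" using x' by simp
      with \<open>g dvd x\<close> have "g \<le> N" "x' \<le> N"
        using dvd_imp_le[OF _ \<open>x > 0\<close>] le by (meson le_trans)+
      moreover have "y' * (g\<^sup>2 * x') \<le> N"
        using *(3) unfolding x' y' by (simp only: power2_eq_square mult_ac)
      then have "y' \<le> N div (g\<^sup>2 * x')"
        using pos \<open>g > 0\<close> by (simp add: less_eq_div_iff_mult_less_eq)
      ultimately have "(x', y') \<in> (SIGMA x:{1..N}. {1..N div (g\<^sup>2 * x)})"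
        using pos by simp
      moreover have "(x, y) = (\<lambda>(x, y). (g * x, g * y)) (x', y')"
        using x' y' by simp
      ultimately have "(x, y) \<in> M g"
        unfolding M_def by (rule rev_image_eqI)
      then show False using xy \<open>g \<ge> 2\<close> \<open>g \<le> N\<close> by auto
    qed
    then show "(x, y) \<in> coprime_pairs N"
      using * by (auto simp: coprime_pairs_def Suc_le_eq)
  qed
  then have "card A \<le> card (coprime_pairs N \<union> (\<Union>g\<in>{2..N}. M g))"
    using fin finite_coprime_pairs by (intro card_mono) auto
  also have "\<dots> \<le> card (coprime_pairs N) + card (\<Union>g\<in>{2..N}. M g)"
    by (rule card_Un_le)
  also have "card (\<Union>g\<in>{2..N}. M g) \<le> (\<Sum>g=2..N. card (M g))"
    by (rule card_UN_le) simp
  finally have "card A \<le> card (coprime_pairs N) + (\<Sum>g=2..N. card (M g))" by simp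
  then have "real (card A) \<le> real (card (coprime_pairs N) + (\<Sum>g=2..N. card (M g)))"
    by (rule of_nat_mono)
  then have "real (card A) \<le> real (card (coprime_pairs N)) + (\<Sum>g=2..N. real (card (M g)))"
    by (simp only: of_nat_add of_nat_sum)
  moreover have "real N * harm N - real N \<le> real (card A)"
  proof -
    have "real N * harm N - real N = (\<Sum>x=1..N. real N / real x - 1)"
      by (simp add: harm_def sum_subtractf sum_distrib_left divide_inverse)
    also have "\<dots> \<le> (\<Sum>x=1..N. real (N div x))"
    proof (rule sum_mono)
      fix x assume "x \<in> {1..N}"
      then have "N < x * (N div x + 1)"
        using dividend_less_times_div[of x N] by simp
      then have "real N < real (x * (N div x + 1))"
        by (simp only: of_nat_less_iff)
      then have "real N < real x * (real (N div x) + 1)"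
        by (simp only: of_nat_mult of_nat_add of_nat_1)
      then show "real N / real x - 1 \<le> real (N div x)"
        using \<open>x \<in> {1..N}\<close> by (simp add: field_simps)
    qed
    also have "\<dots> = real (card A)" by (simp add: A_def)
    finally show ?thesis .
  qed
  moreover have "(\<Sum>g=2..N. real (card (M g))) \<le> real N * harm N * (3 / 4)"
  proof -
    have "real (card (M g)) \<le> real N * harm N * (1 / real g ^ 2)" for g
    proof -
      have "card (M g) \<le> card (SIGMA x:{1..N}. {1..N div (g\<^sup>2 * x)})"
        unfolding M_def by (intro card_image_le) auto
      also have "\<dots> = (\<Sum>x=1..N. N div (g\<^sup>2 * x))" by simp
      finally have "real (card (M g)) \<le> real (\<Sum>x=1..N. N div (g\<^sup>2 * x))"
        by (rule of_nat_mono)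
      also have "\<dots> = (\<Sum>x=1..N. real (N div (g\<^sup>2 * x)))"
        by (rule of_nat_sum)
      also have "\<dots> \<le> (\<Sum>x=1..N. real N / real (g\<^sup>2 * x))"
        by (intro sum_mono of_nat_div_le_of_nat)
      also have "\<dots> = real N * harm N * (1 / real g ^ 2)"
        by (simp add: harm_def sum_distrib_left sum_distrib_right divide_inverse mult_ac)
      finally show ?thesis .
    qed
    then have "(\<Sum>g=2..N. real (card (M g))) \<le> (\<Sum>g=2..N. real N * harm N * (1 / real g ^ 2))"
      by (intro sum_mono)
    also have "\<dots> = real N * harm N * (\<Sum>g=2..N. 1 / real g ^ 2)"
      by (simp add: sum_distrib_left)
    also have "\<dots> \<le> real N * harm N * (3 / 4)"
      by (intro mult_left_mono sum_inverse_squares_le) (auto simp: harm_nonneg)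
    finally show ?thesis .
  qed
  ultimately show ?thesis by (simp add: algebra_simps)
qed

section \<open>Bezout solutions and their children\<close>

lemma coprime_bezout_ex:
  fixes x y :: nat
  assumes "coprime x y" "x \<ge> 2" "y \<ge> 2"
  shows "\<exists>z w. 0 < z \<and> z < x \<and> 0 < w \<and> w < y \<and> x * w = y * z + 1"
proof -
  obtain u where u: "[x * u = 1] (mod y)"
    using cong_solve_coprime_nat[OF assms(1)] by auto
  \<comment> \<open>\<open>w\<close> is the reduced inverse of \<open>x\<close> modulo
    \<open>y\<close> and \<open>z\<close> the resulting quotient. The bound w < y forces z < x, and
    x \<ge> 2 excludes z = 0.\<close>
  define w where "w = u mod y"
  have w: "w < y" "(x * w) mod y = 1"
    using u assms(3) by (auto simp: w_def cong_def mod_mult_right_eq)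
  define z where "z = (x * w) div y"
  have eq: "x * w = y * z + 1"
    using w(2) by (metis z_def mult_div_mod_eq)
  have "0 < w" using eq by (auto intro: gr0I)
  have "0 < z"
  proof (rule gr0I)
    assume "z = 0"
    then have "x * w = 1" using eq by simp
    then show False using assms(2) by simp
  qed
  have "y * z < y * x"
  proof -
    have "y * z < x * w" using eq by simp
    also have "\<dots> \<le> y * x" using w(1) by (simp add: mult.commute)
    finally show ?thesis .
  qed
  then have "z < x" by simp
  then show ?thesis using w(1) eq \<open>0 < w\<close> \<open>0 < z\<close> by blast
qed

text \<open>The equation fixes \<open>y\<close> modulo \<open>w\<close>, so \<open>y div w\<close>
  determines the child. From y^2 z \<le> x y w \<le> N w follows y / w \<le> sqrt (N / (z w)). Since
  w < y, the quotient is at least 1, so the count carries no additive constant.\<close>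

lemma card_children_le:
  fixes z w N :: nat
  assumes "coprime z w" "0 < z" "0 < w"
  defines "C \<equiv> {(x, y). z < x \<and> w < y \<and> x * w = y * z + 1 \<and> x * y \<le> N}"
  shows "finite C" "real (card C) \<le> sqrt (N / (z * w))"
proof -
  define R where "R = sqrt (N / (z * w))"
  let ?f = "\<lambda>(x, y). y div w :: nat"
  have inj: "inj_on ?f C"
  proof (rule inj_onI, clarify)
    fix x y x' y' assume *: "(x, y) \<in> C" "(x', y') \<in> C" "y div w = y' div w"
    have "[y * z + 1 = y' * z + 1] (mod w)"
      using * by (auto simp: C_def cong_def simp flip: Suc_eq_plus1)
        (metis mod_mult_self2_is_0)
    then have "[y * z = y' * z] (mod w)"
      by (rule cong_add_rcancel_nat[THEN iffD1])
    then have "[y = y'] (mod w)"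
      using assms(1) by (simp add: cong_mult_rcancel_nat)
    then have "y = y'"
      using *(3) by (metis cong_def mult_div_mod_eq)
    moreover from this have "x * w = x' * w" using * by (simp add: C_def)
    ultimately show "x = x' \<and> y = y'" using assms(3) by simp
  qed
  have sub: "?f ` C \<subseteq> {1..nat \<lfloor>R\<rfloor>}"
  proof clarify
    fix x y assume "(x, y) \<in> C"
    then have *: "w < y" "x * w = y * z + 1" "x * y \<le> N" by (auto simp: C_def)
    have "y * (y * z) \<le> y * (x * w)" using *(2) by simp
    also have "\<dots> \<le> N * w" using *(3) by (simp add: mult.commute mult.left_commute)
    finally have "real y * (real y * real z) \<le> real N * real w"
      by (metis of_nat_mono of_nat_mult)
    then have "(real y / real w)\<^sup>2 \<le> N / (z * w)"
      using assms by (simp add: field_simps power2_eq_square)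
    then have "real y / real w \<le> R" unfolding R_def by (rule real_le_rsqrt)
    then have "real (y div w) \<le> R" using of_nat_div_le_of_nat[of y w, where 'a = real] by linarith
    then have "y div w \<le> nat \<lfloor>R\<rfloor>" by (simp add: le_nat_floor)
    moreover have "y div w \<ge> 1" using *(1) assms(3) by (simp add: Suc_le_eq div_greater_zero_iff)
    ultimately show "y div w \<in> {1..nat \<lfloor>R\<rfloor>}" by simp
  qed
  show "finite C" using inj sub by (meson finite_atLeastAtMost inj_on_finite)
  have "card C \<le> nat \<lfloor>R\<rfloor>" using card_inj_on_le[OF inj sub] by simp
  moreover have "real (nat \<lfloor>R\<rfloor>) \<le> R" by (simp add: R_def)
  ultimately show "real (card C) \<le> sqrt (N / (z * w))" unfolding R_def by linarith
qed

subsection \<open>Numbers with many prime factors\<close>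

text \<open>Interpolation: below the threshold, a factor \<open>T powr s\<close> may replace the
  power \<open>s\<close> of 2^\<omega>(b). The remaining power is (1 + \<alpha>)^\<omega>(b) with 1
  + \<alpha> = 2^(1-s), to which the moment bound applies.\<close>

lemma sum_few_prime_factors_le:
  fixes s T :: real and N :: nat
  assumes "N \<ge> 2" "0 < s" "s < 1" "T > 0"
  shows "(\<Sum>b=1..N. 2 ^ card (prime_factors b) *
      (if 2 ^ card (prime_factors b) < T then sqrt (N / b) else 0))
    \<le> T powr s * (2 * exp 3 * N * (1 + ln N) powr (2 powr (1 - s) - 1))"
proof -
  define \<alpha> where "\<alpha> = 2 powr (1 - s) - (1 :: real)"
  have "2 powr 0 \<le> (2 :: real) powr (1 - s)" "2 powr (1 - s) \<le> (2 :: real) powr 1"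
    using assms by (intro powr_mono; simp)+
  then have \<alpha>: "0 \<le> \<alpha>" "\<alpha> \<le> 1" by (auto simp: \<alpha>_def)
  have pow: "2 ^ k \<le> T powr s * (1 + \<alpha>) ^ k" if "2 ^ k < T" for k :: nat
  proof -
    have "(2 :: real) ^ k = (2 ^ k) powr s * (2 ^ k) powr (1 - s)"
      by (simp flip: powr_add)
    also have "\<dots> \<le> T powr s * (2 ^ k) powr (1 - s)"
      using that assms by (intro mult_right_mono powr_mono2) auto
    also have "(2 ^ k) powr (1 - s) = (1 + \<alpha>) ^ k"
      by (simp add: \<alpha>_def powr_realpow[symmetric] powr_powr mult.commute)
    finally show ?thesis .
  qed
  have "(\<Sum>b=1..N. 2 ^ card (prime_factors b) *
      (if 2 ^ card (prime_factors b) < T then sqrt (N / b) else 0))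
    \<le> (\<Sum>b=1..N. T powr s * ((1 + \<alpha>) ^ card (prime_factors b) * sqrt (N / b)))"
  proof (rule sum_mono)
    fix b :: nat
    show "2 ^ card (prime_factors b) *
        (if 2 ^ card (prime_factors b) < T then sqrt (N / b) else 0)
      \<le> T powr s * ((1 + \<alpha>) ^ card (prime_factors b) * sqrt (N / b))"
    proof (cases "2 ^ card (prime_factors b) < T")
      case True
      then show ?thesis
        using mult_right_mono[OF pow[OF True], of "sqrt (N / b)"] by (simp add: mult.assoc)
    next
      case False
      then show ?thesis using \<alpha> by (simp del: real_sqrt_divide)
    qed
  qed
  also have "\<dots> \<le> T powr s * (2 * exp 3 * N * (1 + ln N) powr \<alpha>)"
    unfolding sum_distrib_left[symmetric]
    using assms \<alpha> by (intro mult_left_mono sum_power_card_prime_factors_le) auto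
  finally show ?thesis by (simp only: \<alpha>_def)
qed

definition rich :: "nat \<Rightarrow> real \<Rightarrow> nat set" where
  "rich N T = {b \<in> {1..N}. T \<le> 2 ^ card (prime_factors b)}"

lemma finite_rich: "finite (rich N T)"
  by (simp add: rich_def)

lemma one_le_sqrt_divide:
  fixes N b :: nat
  assumes "b \<in> {1..N}"
  shows "1 \<le> sqrt (N / b)"
  using assms by (intro real_le_rsqrt) (simp add: field_simps)

text \<open>Markov's inequality for 2^\<omega>(b), the moment with \<alpha> = 1. The weight sqrt (N
  / b) is at least 1, so inserting it is harmless and lets the same moment bound be used.\<close>

lemma card_rich_le:
  fixes N :: nat and T :: real
  assumes "N \<ge> 2" "T > 0"
  shows "real (card (rich N T)) * T \<le> 2 * exp 3 * N * (1 + ln N)"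
proof -
  have "real (card (rich N T)) * T = (\<Sum>b\<in>rich N T. T)" by simp
  also have "\<dots> \<le> (\<Sum>b\<in>rich N T. 2 ^ card (prime_factors b) * sqrt (N / b))"
  proof (rule sum_mono)
    fix b assume b: "b \<in> rich N T"
    then have "T * 1 \<le> 2 ^ card (prime_factors b) * sqrt (N / b)"
      using assms one_le_sqrt_divide[of b N] by (intro mult_mono) (auto simp: rich_def)
    then show "T \<le> 2 ^ card (prime_factors b) * sqrt (N / b)" by simp
  qed
  also have "\<dots> \<le> (\<Sum>b=1..N. 2 ^ card (prime_factors b) * sqrt (N / b))"
    by (rule sum_mono2) (auto simp: rich_def)
  also have "\<dots> \<le> 2 * exp 3 * N * (1 + ln N)"
    using sum_power_card_prime_factors_le[OF assms(1), of 1] assms(1) by simp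
  finally show ?thesis .
qed

section \<open>Edges from coprime pairs\<close>

lemma bezout_square:
  fixes x y z w :: nat
  assumes "x * w = y * z + 1"
  shows "2 * (x * y) * (2 * (z * w)) + 1 = (2 * (y * z) + 1) ^ 2"
proof -
  have "2 * (x * y) * (2 * (z * w)) = 4 * ((y * z) * (x * w))"
    by simp
  then show ?thesis
    unfolding assms by (simp add: power2_eq_square algebra_simps)
qed

text \<open>The two products determine the square, hence y z. As \<open>x\<close> and
  \<open>z\<close> are coprime by the Bezout equation, \<open>y\<close> is the gcd of x y and y
  z.\<close>

lemma bezout_unique:
  fixes x y z w x' y' z' w' :: nat
  assumes "x * w = y * z + 1" "x' * w' = y' * z' + 1"
    and "x * y = x' * y'" "z * w = z' * w'" "y > 0"
  shows "x = x' \<and> y = y'"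
proof -
  have "(2 * (y * z) + 1) ^ 2 = (2 * (y' * z') + 1) ^ 2"
    using bezout_square[OF assms(1)] bezout_square[OF assms(2)] assms(3,4) by simp
  then have yz: "y * z = y' * z'"
    by (simp add: power2_eq_iff_nonneg)
  have cop: "coprime a c" if "a * d = b * c + 1" for a b c d :: nat
  proof (rule coprimeI)
    fix p assume "p dvd a" "p dvd c"
    then have "p dvd b * c + 1" "p dvd b * c" using that by (metis dvd_mult2, simp)
    then show "is_unit p" using dvd_add_right_iff by blast
  qed
  have "y = gcd (y * x) (y * z)"
    using cop[OF assms(1)] by (simp add: gcd_mult_distrib_nat[symmetric] coprime_iff_gcd_eq_1)
  also have "\<dots> = gcd (y' * x') (y' * z')"
    using yz assms(3) by (simp add: mult.commute)
  also have "\<dots> = y'"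
    using cop[OF assms(2)] by (simp add: gcd_mult_distrib_nat[symmetric] coprime_iff_gcd_eq_1)
  finally show ?thesis using assms(3,5) by auto
qed

lemma finite_snd_diophantine_graph:
  assumes "finite V"
  shows "finite (snd (diophantine_graph V))"
  by (rule finite_subset[of _ "Pow V"]) (auto simp: diophantine_graph_def assms)

text \<open>This crude bound serves to make the vertex number arbitrarily large: many edges force
  many vertices.\<close>

lemma num_edges_le_square:
  assumes "finite V"
  shows "num_edges (diophantine_graph V) \<le> card V ^ 2"
proof -
  have "snd (diophantine_graph V) \<subseteq> (\<lambda>(a, b). {a, b}) ` (V \<times> V)"
    by (auto simp: diophantine_graph_def)
  then have "card (snd (diophantine_graph V)) \<le> card (V \<times> V)"
    using assms by (intro surj_card_le) simp_all
  then show ?thesis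
    by (simp add: num_edges_def card_cartesian_product power2_eq_square)
qed

text \<open>The term \<open>2 * W\<close> accounts for the pairs \<open>(x, y)\<close> with \<open>xy\<close> not rich and for those with \<open>zw\<close> not rich;
  the latter are grouped by \<open>(z, w)\<close>, which has at most \<open>sqrt (N / (zw))\<close> children \<open>(x, y)\<close>.\<close>

lemma num_edges_rich_ge:
  fixes N :: nat and T :: real
  assumes "N \<ge> 2"
  defines "W \<equiv> \<Sum>b=1..N. 2 ^ card (prime_factors b) *
      (if 2 ^ card (prime_factors b) < T then sqrt (N / b) else 0)"
  shows "real (num_edges (diophantine_graph ((\<lambda>b. 2 * b) ` rich N T)))
    \<ge> real N * (harm N / 4 - 3) - 2 * W"
proof -
  obtain z w :: "nat \<Rightarrow> nat \<Rightarrow> nat" where zw: "\<And>x y. coprime x y \<Longrightarrow> x \<ge> 2 \<Longrightarrow> y \<ge> 2 \<Longrightarrow>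
      0 < z x y \<and> z x y < x \<and> 0 < w x y \<and> w x y < y \<and> x * w x y = y * z x y + 1"
    using coprime_bezout_ex by metis
  define poor where "poor b \<longleftrightarrow> 2 ^ card (prime_factors b) < T" for b :: nat
  define \<phi> where "\<phi> b = (if poor b then sqrt (N / b) else 0)" for b :: nat
  \<comment> \<open>\<open>G\<close> collects the pairs whose edge survives, \<open>B\<close> the
    pairs with poor product, and \<open>ch q\<close> the possible children of the pair
    \<open>q\<close>.\<close>
  define G where "G = {(x, y) \<in> coprime_pairs N. 2 \<le> x \<and> 2 \<le> y \<and>
      x * y \<in> rich N T \<and> z x y * w x y \<in> rich N T}"
  define B where "B = {(x, y) \<in> coprime_pairs N. poor (x * y)}"
  define ch where "ch = (\<lambda>(u, v). {(x, y). u < x \<and> v < y \<and> x * v = y * u + 1 \<and> x * y \<le> N})"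
  have W: "(\<Sum>(x, y)\<in>coprime_pairs N. \<phi> (x * y)) \<le> W"
    using sum_coprime_pairs_le[of \<phi> N] by (simp add: W_def \<phi>_def poor_def)
  have sum_B: "(\<Sum>(x, y)\<in>B. sqrt (N / (x * y))) \<le> W"
  proof -
    have "(\<Sum>(x, y)\<in>B. sqrt (N / (x * y))) = (\<Sum>(x, y)\<in>coprime_pairs N. \<phi> (x * y))"
      using finite_coprime_pairs[of N]
      by (intro sum.mono_neutral_cong_left) (auto simp: B_def \<phi>_def split: if_splits)
    then show ?thesis using W by simp
  qed
  have finB: "finite B"
    using finite_coprime_pairs[of N] by (auto simp: B_def intro: finite_subset)
  have "real (card B) \<le> (\<Sum>(x, y)\<in>B. sqrt (N / (x * y)))"
  proof -
    have "real (card B) = (\<Sum>q\<in>B. 1)" by simp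
    also have "\<dots> \<le> (\<Sum>(x, y)\<in>B. sqrt (N / (x * y)))"
    proof (rule sum_mono, clarify)
      fix x y assume "(x, y) \<in> B"
      then have "x * y \<in> {1..N}" by (simp add: B_def coprime_pairs_def)
      from one_le_sqrt_divide[OF this] show "1 \<le> sqrt (N / (x * y))"
        by (simp only: of_nat_mult)
    qed
    finally show ?thesis .
  qed
  with sum_B have card_B: "real (card B) \<le> W" by linarith
  have ch: "finite (ch q)" "real (card (ch q)) \<le> sqrt (N / real (fst q * snd q))"
    if "q \<in> B" for q
  proof -
    obtain u v where q: "q = (u, v)" by force
    have uv: "coprime u v" "0 < u" "0 < v"
      using that by (auto simp: q B_def coprime_pairs_def intro: gr0I)
    show "finite (ch q)" "real (card (ch q)) \<le> sqrt (N / real (fst q * snd q))"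
      using card_children_le[OF uv, of N] by (simp_all add: q ch_def)
  qed
  have "real (card (\<Union>q\<in>B. ch q)) \<le> (\<Sum>q\<in>B. real (card (ch q)))"
  proof -
    have "card (\<Union>q\<in>B. ch q) \<le> (\<Sum>q\<in>B. card (ch q))"
      using finB by (rule card_UN_le)
    then have "real (card (\<Union>q\<in>B. ch q)) \<le> real (\<Sum>q\<in>B. card (ch q))"
      by (rule of_nat_mono)
    then show ?thesis by (simp only: of_nat_sum)
  qed
  also have "\<dots> \<le> (\<Sum>q\<in>B. sqrt (N / real (fst q * snd q)))"
    using ch(2) by (rule sum_mono)
  also have "\<dots> = (\<Sum>(u, v)\<in>B. sqrt (N / (u * v)))"
    by (simp add: case_prod_beta)
  finally have card_ch: "real (card (\<Union>q\<in>B. ch q)) \<le> W" using sum_B by linarith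
  have finG: "finite G"
    using finite_coprime_pairs[of N] by (auto simp: G_def intro: finite_subset)

  \<comment> \<open>Pairs with a coordinate 1 fall outside the Bezout lemma. There are at most 2N of
    them, which turns the -1 of the count of coprime pairs into -3.\<close>
  define E where "E = {1} \<times> {1..N} \<union> {1..N} \<times> {1::nat}"
  have card_E: "finite E" "card E \<le> 2 * N"
    using card_Un_le[of "{1} \<times> {1..N}" "{1..N} \<times> {1::nat}"]
    by (auto simp: E_def card_cartesian_product)
  \<comment> \<open>A pair outside \<open>E\<close>, \<open>B\<close> and \<open>G\<close> has a
    rich product but a poor z w. Its Bezout pair is again coprime with product at most N, so it lies
    in \<open>B\<close> and the pair is one of its children.\<close>
  have "coprime_pairs N \<subseteq> E \<union> B \<union> (\<Union>q\<in>B. ch q) \<union> G"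
  proof (rule subsetI, rule ccontr)
    fix q assume q: "q \<in> coprime_pairs N" "q \<notin> E \<union> B \<union> (\<Union>q\<in>B. ch q) \<union> G"
    obtain x y where "q = (x, y)" by force
    with q have xy: "(x, y) \<in> coprime_pairs N" "(x, y) \<notin> G" "(x, y) \<notin> E" "(x, y) \<notin> B"
      "(x, y) \<notin> (\<Union>q\<in>B. ch q)" by simp_all
    then have *: "coprime x y" "0 < x" "0 < y" "x * y \<le> N"
      by (auto simp: coprime_pairs_def intro: gr0I)
    have "x \<le> x * y" "y \<le> x * y" using * by auto
    with *(4) have "x \<le> N" "y \<le> N" by linarith+
    have "x \<ge> 2" "y \<ge> 2"
      using * xy(3) \<open>x \<le> N\<close> \<open>y \<le> N\<close> by (auto simp: E_def)
    from zw[OF *(1) this] have zw': "0 < z x y" "z x y < x" "0 < w x y" "w x y < y"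
      "x * w x y = y * z x y + 1" by auto
    have "z x y * w x y \<le> x * y" using zw' by (intro mult_le_mono) auto
    with *(4) have le: "z x y * w x y \<le> N" by linarith
    have "coprime (z x y) (w x y)"
    proof (rule coprimeI)
      fix p assume "p dvd z x y" "p dvd w x y"
      then have "p dvd y * z x y + 1" "p dvd y * z x y"
        using zw'(5) by (metis dvd_mult, simp)
      then show "is_unit p" using dvd_add_right_iff by blast
    qed
    then have "(z x y, w x y) \<in> coprime_pairs N"
      using le zw' by (auto simp: coprime_pairs_def Suc_le_eq)
    moreover have "poor (z x y * w x y)"
      using xy(1-4) * \<open>x \<ge> 2\<close> \<open>y \<ge> 2\<close> zw' le
      by (auto simp: G_def B_def rich_def poor_def not_less Suc_le_eq)
    ultimately have "(z x y, w x y) \<in> B" by (simp add: B_def)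
    moreover have "(x, y) \<in> ch (z x y, w x y)"
      using zw' *(4) by (simp add: ch_def)
    ultimately show False using xy(5) by blast
  qed
  then have "card (coprime_pairs N) \<le> card (E \<union> B \<union> (\<Union>q\<in>B. ch q) \<union> G)"
    using card_E(1) finB ch(1) finG by (intro card_mono) auto
  also have "\<dots> \<le> card E + card B + card (\<Union>q\<in>B. ch q) + card G"
    by (meson card_Un_le add_le_mono le_trans order_refl)
  finally have "card (coprime_pairs N) \<le> card E + card B + card (\<Union>q\<in>B. ch q) + card G" .
  then have "real (card (coprime_pairs N)) \<le> 2 * real N + 2 * W + real (card G)"
    using card_E(2) card_B card_ch by linarith
  then have "real N * (harm N / 4 - 3) - 2 * W \<le> real (card G)"
    using card_coprime_pairs_ge[of N] by (simp add: algebra_simps)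
  also have "card G \<le> num_edges (diophantine_graph ((\<lambda>b. 2 * b) ` rich N T))"
    unfolding num_edges_def
  proof (rule card_inj_on_le)
    let ?f = "\<lambda>(x, y). {2 * (x * y), 2 * (z x y * w x y)}"
    have G: "coprime x y" "y > 0" "x * w x y = y * z x y + 1" "z x y * w x y < x * y"
      "x * y \<in> rich N T" "z x y * w x y \<in> rich N T" if "(x, y) \<in> G" for x y
    proof -
      have *: "coprime x y" "x \<ge> 2" "y \<ge> 2" "x * y \<in> rich N T" "z x y * w x y \<in> rich N T"
        using that by (auto simp: G_def coprime_pairs_def)
      from zw[OF *(1-3)] * show "coprime x y" "y > 0" "x * w x y = y * z x y + 1"
        "z x y * w x y < x * y" "x * y \<in> rich N T" "z x y * w x y \<in> rich N T"
        by (auto intro: mult_strict_mono)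
    qed
    show "inj_on ?f G"
    proof (rule inj_onI, clarify)
      fix x y x' y' assume g: "(x, y) \<in> G" "(x', y') \<in> G"
        and eq: "{2 * (x * y), 2 * (z x y * w x y)} = {2 * (x' * y'), 2 * (z x' y' * w x' y')}"
      \<comment> \<open>In every such edge the endpoint 2xy is the larger one, so equal unordered
        edges have equal endpoints in order.\<close>
      have "x * y = x' * y' \<and> z x y * w x y = z x' y' * w x' y'"
        using eq G(4)[OF g(1)] G(4)[OF g(2)] unfolding doubleton_eq_iff by linarith
      then show "x = x' \<and> y = y'"
        using bezout_unique[OF G(3)[OF g(1)] G(3)[OF g(2)]] G(2)[OF g(1)] by blast
    qed
    show "?f ` G \<subseteq> snd (diophantine_graph ((\<lambda>b. 2 * b) ` rich N T))"
    proof clarify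
      fix x y assume g: "(x, y) \<in> G"
      have "is_square (2 * (x * y) * (2 * (z x y * w x y)) + 1)"
        unfolding bezout_square[OF G(3)[OF g]] by (rule is_nth_power_nth_power)
      moreover have "2 * (x * y) \<noteq> 2 * (z x y * w x y)" using G(4)[OF g] by simp
      ultimately show "{2 * (x * y), 2 * (z x y * w x y)}
          \<in> snd (diophantine_graph ((\<lambda>b. 2 * b) ` rich N T))"
        using G(5,6)[OF g] unfolding diophantine_graph_def snd_conv by blast
    qed
    show "finite (snd (diophantine_graph ((\<lambda>b. 2 * b) ` rich N T)))"
      by (intro finite_snd_diophantine_graph finite_imageI finite_rich)
  qed
  finally show ?thesis by simp
qed

text \<open>The left-hand side equals 1 at \<open>s = 0\<close> and has derivative \<open>D - 2 ln 2 < 0\<close> there.\<close>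

lemma exponent_gap_ex:
  fixes D :: real
  assumes "D < 2 * ln 2"
  obtains s where "0 < s" "s < 1" "2 powr (1 - s) - 1 + s * D < 1"
proof -
  define f where "f s = 2 powr (1 - s) - 1 + s * D" for s :: real
  have "(f has_real_derivative (D - 2 * ln 2)) (at 0)"
    unfolding f_def by (auto intro!: derivative_eq_intros)
  from DERIV_neg_dec_right[OF this] assms
  obtain d where d: "d > 0" "\<And>h. h > 0 \<Longrightarrow> h < d \<Longrightarrow> f (0 + h) < f 0" by auto
  define s where "s = min (d / 2) (1 / 2)"
  have "f s < f 0" using d(2)[of s] d(1) by (auto simp: s_def)
  then show thesis using d(1) by (intro that[of s]) (auto simp: s_def f_def)
qed

section \<open>Choice of the parameters and conclusion\<close>

theorem theorem2:
  fixes \<epsilon> :: real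
  assumes "\<epsilon> > 0"
  shows "\<forall>N::nat. \<exists>n\<ge>N. n > 0 \<and>
           (\<exists>V::nat set. finite V \<and> card V = n \<and> (\<forall>v\<in>V. v > 0) \<and>
              real (num_edges (diophantine_graph V)) > real n * ln (real n) powr (2 * ln 2 - \<epsilon>))"
proof
  fix N0 :: nat
  \<comment> \<open>Two copies of \<delta> fit into \<epsilon>: one lowers the exponent of the
    threshold to \<open>D\<close>, the other leaves a spare factor \<open>L powr \<delta>\<close> to
    absorb constants. The cap 1/2 keeps D - \<delta> positive.\<close>
  define \<delta> where "\<delta> = min \<epsilon> 1 / 2"
  define D where "D = 2 * ln 2 - \<delta>"
  have \<delta>: "0 < \<delta>" "2 * \<delta> \<le> \<epsilon>" "\<delta> \<le> 1 / 2" using assms by (auto simp: \<delta>_def)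
  obtain s where s: "0 < s" "s < 1" "2 powr (1 - s) - 1 + s * D < 1"
    using exponent_gap_ex[of D] \<delta>(1) by (auto simp: D_def)
  \<comment> \<open>With T = L^D the lost edges are of order N L^\<beta>, and \<beta> < 1 makes them
    negligible against N L.\<close>
  define \<beta> where "\<beta> = 2 powr (1 - s) - 1 + s * D"
  have "\<forall>\<^sub>F L in at_top. 4 * exp 3 * L powr \<beta> \<le> L / 16 - (4::real)"
    using s(3) unfolding \<beta>_def[symmetric] by real_asymp
  moreover have "\<forall>\<^sub>F L in at_top. 16 * exp 3 < (L::real) powr \<delta>"
    using \<delta>(1) by real_asymp
  ultimately have "\<forall>\<^sub>F L::real in at_top. 4 * exp 3 * L powr \<beta> \<le> L / 16 - 4 \<and> 16 * exp 3 < L powr \<delta>"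
    by eventually_elim simp
  moreover have "filterlim (\<lambda>N::nat. 1 + ln (real N)) at_top sequentially"
    by real_asymp
  ultimately have "\<forall>\<^sub>F N::nat in sequentially. 4 * exp 3 * (1 + ln N) powr \<beta> \<le> (1 + ln N) / 16 - 4
      \<and> 16 * exp 3 < (1 + ln N) powr \<delta>"
    by (rule eventually_compose_filterlim)
  then obtain N1 :: nat where N1: "\<And>N::nat. N \<ge> N1 \<Longrightarrow> 4 * exp 3 * (1 + ln N) powr \<beta> \<le> (1 + ln N) / 16 - 4"
      "\<And>N::nat. N \<ge> N1 \<Longrightarrow> 16 * exp 3 < (1 + ln N) powr \<delta>"
    by (auto simp: eventually_sequentially)
  \<comment> \<open>At least N / 8 edges and at most n^2 edges on n vertices give n \<ge> max N0 3.
    The 3 ensures ln n \<ge> 1, so that powers of ln n increase with the exponent.\<close>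
  define N where "N = max N1 (8 * (max N0 3)\<^sup>2)"
  define L where "L = 1 + ln (real N)"
  define T where "T = L powr D"
  define V where "V = (\<lambda>b. 2 * b) ` rich N T"
  have "N \<ge> 8 * (max N0 3)\<^sup>2" by (simp add: N_def)
  moreover have "(3::nat)\<^sup>2 \<le> (max N0 3)\<^sup>2" by (intro power_mono) auto
  ultimately have "N \<ge> 2" by simp
  have L: "L > 1" using \<open>N \<ge> 2\<close> by (simp add: L_def)
  then have T: "T > 0" by (simp add: T_def)
  have NL: "4 * exp 3 * L powr \<beta> \<le> L / 16 - 4" "16 * exp 3 < L powr \<delta>"
    using N1[of N] by (auto simp: N_def L_def)
  have finV: "finite V" by (simp add: V_def finite_rich)
  have card_V: "card V = card (rich N T)"
    unfolding V_def by (intro card_image) (auto simp: inj_on_def)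

  \<comment> \<open>The main term is at least N ((L - 1) / 4 - 3) and the loss at most N (L / 16 -
    4). Their difference is N (3 L / 16 + 3 / 4), more than N L / 8.\<close>
  have "real N * (L / 8) \<le> real (num_edges (diophantine_graph V))"
  proof -
    define W where "W = (\<Sum>b=1..N. 2 ^ card (prime_factors b) *
      (if 2 ^ card (prime_factors b) < T then sqrt (N / b) else 0))"
    have "W \<le> T powr s * (2 * exp 3 * N * L powr (2 powr (1 - s) - 1))"
      unfolding W_def L_def using \<open>N \<ge> 2\<close> s T by (intro sum_few_prime_factors_le) auto
    also have "\<dots> = 2 * exp 3 * N * L powr \<beta>"
      by (simp add: T_def \<beta>_def powr_powr powr_add mult_ac)
    finally have "2 * W \<le> real N * (4 * exp 3 * L powr \<beta>)" by (simp add: mult_ac)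
    also have "\<dots> \<le> real N * (L / 16 - 4)"
      using NL(1) by (intro mult_left_mono) auto
    finally have W: "2 * W \<le> real N * (L / 16 - 4)" .
    have "L - 1 \<le> harm N"
    proof -
      have "ln (real N) \<le> ln (real N + 1)" using \<open>N \<ge> 2\<close> by simp
      then show ?thesis using ln_le_harm[of N] by (simp add: L_def)
    qed
    then have "real N * ((L - 1) / 4 - 3) \<le> real N * (harm N / 4 - 3)"
      by (intro mult_left_mono) auto
    note diff_mono[OF this W]
    also have "real N * (harm N / 4 - 3) - 2 * W \<le> real (num_edges (diophantine_graph V))"
      unfolding V_def W_def using \<open>N \<ge> 2\<close> by (rule num_edges_rich_ge)
    finally have "real N * ((L - 1) / 4 - 3 - (L / 16 - 4)) \<le> real (num_edges (diophantine_graph V))"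
      by (simp only: right_diff_distrib)
    moreover have "L / 8 \<le> (L - 1) / 4 - 3 - (L / 16 - 4)"
      using L by (simp add: field_simps)
    then have "real N * (L / 8) \<le> real N * ((L - 1) / 4 - 3 - (L / 16 - 4))"
      by (rule mult_left_mono) simp
    ultimately show ?thesis by (rule order_trans[rotated])
  qed
  note edges = this

  have card_ge: "card V \<ge> max N0 3"
  proof -
    have "real (8 * (max N0 3)\<^sup>2) \<le> real N" using \<open>N \<ge> 8 * _\<close> by (rule of_nat_mono)
    also have "\<dots> \<le> real N * L" using L mult_left_mono[of 1 L "real N"] by simp
    also have "\<dots> \<le> 8 * real (num_edges (diophantine_graph V))" using edges by simp
    also have "\<dots> \<le> real (8 * (card V)\<^sup>2)"
      using of_nat_mono[OF num_edges_le_square[OF finV], where 'a = real] by simp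
    finally have "8 * (max N0 3)\<^sup>2 \<le> 8 * (card V)\<^sup>2" by (simp only: of_nat_le_iff)
    then show ?thesis by (simp add: power2_nat_le_eq_le)
  qed
  have "card V \<le> N"
  proof -
    have "rich N T \<subseteq> {1..N}" by (auto simp: rich_def)
    then have "card (rich N T) \<le> card {1..N}" by (intro card_mono) simp_all
    then show ?thesis by (simp add: card_V)
  qed
  have ln_ge: "ln (real (card V)) \<ge> 1"
  proof -
    have "exp 1 \<le> (3::real)" using exp_le .
    then show ?thesis using card_ge by (subst ln_ge_iff) auto
  qed
  have ln_le: "ln (real (card V)) \<le> L"
    using \<open>card V \<le> N\<close> card_ge by (simp add: L_def add_increasing)
  \<comment> \<open>Since ln n \<le> L, the target is at most n T / L^\<delta>, and n T is at most 2
    e^3 N L by the count of rich numbers. As L^\<delta> exceeds 16 e^3, this falls below N L /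
    8.\<close>
  have "ln (real (card V)) powr (2 * ln 2 - \<epsilon>) \<le> ln (real (card V)) powr (D - \<delta>)"
    using ln_ge \<delta> by (intro powr_mono) (auto simp: D_def)
  also have "\<dots> \<le> L powr (D - \<delta>)"
    using ln_ge ln_le \<delta> ln2_ge_two_thirds by (intro powr_mono2) (auto simp: D_def)
  also have "\<dots> = T / L powr \<delta>"
    by (simp add: T_def powr_diff)
  finally have "real (card V) * ln (real (card V)) powr (2 * ln 2 - \<epsilon>)
      \<le> real (card V) * (T / L powr \<delta>)"
    by (intro mult_left_mono) auto
  also have "\<dots> = real (card V) * T / L powr \<delta>" by simp
  also have "\<dots> \<le> 2 * exp 3 * N * L / L powr \<delta>"
    using card_rich_le[OF \<open>N \<ge> 2\<close> T] unfolding card_V L_def by (intro divide_right_mono) auto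
  also have "\<dots> < real N * (L / 8)"
  proof -
    have "N * L * (16 * exp 3) < N * L * L powr \<delta>"
      using NL(2) L \<open>N \<ge> 2\<close> by (intro mult_strict_left_mono) auto
    then show ?thesis using L by (simp add: field_simps)
  qed
  also note edges
  finally have "real (num_edges (diophantine_graph V))
      > real (card V) * ln (real (card V)) powr (2 * ln 2 - \<epsilon>)" .
  moreover have "\<forall>v\<in>V. v > 0" by (auto simp: V_def rich_def)
  ultimately show "\<exists>n\<ge>N0. n > 0 \<and>
      (\<exists>V::nat set. finite V \<and> card V = n \<and> (\<forall>v\<in>V. v > 0) \<and>
        real (num_edges (diophantine_graph V)) > real n * ln (real n) powr (2 * ln 2 - \<epsilon>))"
    using card_ge finV by (intro exI[of _ "card V"]) auto
qed

end
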